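(* Let $p,q$ be positive integers, $n=p+q$, and let $i_1\ne i_2$ be integers with $1\le i_1,i_2\le p$. The $PT$-matrix $A=(C_p\oplus C_q)+T(i_1,n,i_2,p)$ has finite multiplicative order if and only if all of the following conditions hold: (1) $i_1+i_2=p+2$ and $[i_2-1]_2\ge[p-i_2+1]_2$; (2) $g\mid p$, where $g=\gcd(q,p-i_2+1)$; (3) either $[q]_2\le[i_2-1]_2$, or $[q]_2>[i_2-1]_2$ and $p/d$ is an even integer, where $d=\gcd(\frac{q}{2},i_2-1)$.
   Context: $C_k$ is the $k\times k$ permutation matrix with $1$ in positions $(i+1,i)$ for $1\le i\le k-1$ and in position $(1,k)$ (companion matrix of $x^k-1$); $\oplus$ denotes matrix direct sum. $T(i_1,j_1,i_2,j_2)$ (with $i_1\ne i_2$, $j_1\ne j_2$) is the $n\times n$ matrix with $1$ in positions $(i_1,j_1),(i_2,j_2)$, $-1$ in positions $(i_1,j_2),(i_2,j_1)$, $0$ elsewhere. For a positive integer $t$, $[t]_2$ denotes the highest power of $2$ dividing $t$. *)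

theory Defs
  imports "Jordan_Normal_Form.Matrix" "HOL-Computational_Algebra.Primes"
begin

(* Matrices are indexed from 0; entry (i,j) of a matrix written with 1-based
   positions is the entry $$ (i - 1, j - 1). The definitions below
   use 1-based positions, shifting the indices by Suc. *)

(* C_k, the companion matrix of x^k - 1; in particular C_1 = (1). *)
definition cyc_mat :: "nat \<Rightarrow> int mat" where
  "cyc_mat k = mat k k (\<lambda>(a, b). let i = Suc a; j = Suc b in
     if (j < k \<and> i = j + 1) \<or> (i = 1 \<and> j = k) then 1 else 0)"

(* T(i1, j1, i2, j2) of size n, meaningful for i1 \<noteq> i2 and j1 \<noteq> j2,
   with i1, i2, j1, j2 in {1..n}. *)
definition T_mat :: "nat \<Rightarrow> nat \<Rightarrow> nat \<Rightarrow> nat \<Rightarrow> nat \<Rightarrow> int mat" where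
  "T_mat n i1 j1 i2 j2 = mat n n (\<lambda>(a, b). let i = Suc a; j = Suc b in
     if (i, j) = (i1, j1) \<or> (i, j) = (i2, j2) then 1
     else if (i, j) = (i1, j2) \<or> (i, j) = (i2, j1) then -1
     else 0)"

definition finite_mult_order :: "'a :: semiring_1 mat \<Rightarrow> bool" where
  "finite_mult_order A \<longleftrightarrow> (\<exists>m > 0. A ^\<^sub>m m = 1\<^sub>m (dim_row A))"

(* [t]_2 is the power of 2 itself, not its exponent; meaningful for t > 0. *)
definition two_part :: "nat \<Rightarrow> nat" where
  "two_part t = 2 ^ multiplicity 2 t"

end

theory Submission
  imports Defs "HOL-Analysis.Complex_Transcendental"
    "HOL-Computational_Algebra.Fundamental_Theorem_Algebra"
begin

text \<open>
  Put \<open>a = i1 - 1\<close>, \<open>b = i2 - 1\<close> and let \<open>e\<close>, \<open>f\<close> be the first basis vectors of the two blocks.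
  They generate the space under \<open>A\<close>, with the relations \<open>A^p e = e + A^b e - A^a e\<close> and
  \<open>A^q f = f + A^a e - A^b e\<close>. Hence \<open>A\<close> acts as multiplication by \<open>x\<close> on the quotient of
  \<open>C[x]^2\<close> by \<open>(F, 0)\<close> and \<open>(x^b - x^a, x^q - 1)\<close>, where \<open>F = x^p + x^a - x^b - 1\<close>, and
  \<open>A^k = 1\<close> is a divisibility statement about \<open>F\<close>. It forces all roots of \<open>F\<close> to be simple roots
  of unity; comparing \<open>F\<close> with its reciprocal polynomial gives \<open>a + b = p\<close>, so
  \<open>F = (x^a - 1) (x^b + 1)\<close>. What remains is that the two factors have no common root and that
  every common root of \<open>F\<close> and \<open>x^q - 1\<close> is a \<open>p\<close>-th root of unity, and the three numerical
  conditions say exactly this.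
\<close>

section \<open>Monomials and the polynomial \<open>F\<close>\<close>

definition xpow :: "nat \<Rightarrow> complex poly" where
  "xpow k = monom 1 k"

lemma xpow_0 [simp]: "xpow 0 = 1"
  by (simp add: xpow_def)

lemma xpow_add: "xpow (k + l) = xpow k * xpow l"
  by (simp add: xpow_def mult_monom)

lemma poly_xpow [simp]: "poly (xpow k) z = z ^ k"
  by (simp add: xpow_def poly_monom)

lemma degree_xpow [simp]: "degree (xpow k) = k"
  by (simp add: xpow_def degree_monom_eq)

lemma coeff_xpow: "coeff (xpow k) i = (if i = k then 1 else 0)"
  by (simp add: xpow_def)

lemma degree_xpow_minus_1 [simp]: "degree (xpow k - 1) = k"
proof (cases "k = 0")
  case False
  then have "degree (xpow k + (- 1)) = degree (xpow k)"
    by (intro degree_add_eq_left) simp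
  then show ?thesis by simp
qed simp

definition pert_poly :: "nat \<Rightarrow> nat \<Rightarrow> nat \<Rightarrow> complex poly" where
  "pert_poly p a b = xpow p + xpow a - xpow b - 1"

lemma degree_pert_poly:
  assumes "a < p" "b < p"
  shows "degree (pert_poly p a b) = p"
proof -
  have "degree (xpow a - xpow b - 1) < p"
    using assms by (intro degree_diff_less) auto
  then have "degree (xpow p + (xpow a - xpow b - 1)) = p"
    by (subst degree_add_eq_left) auto
  then show ?thesis by (simp add: pert_poly_def algebra_simps)
qed

section \<open>Coordinates in the quotient module\<close>

text \<open>Coordinate \<open>r\<close> of the class of \<open>(g, h)\<close> in the quotient module: first \<open>h\<close> is reduced
  modulo \<open>x^q - 1\<close>, and its quotient is carried into the first component.\<close>
definition residue_entry :: "nat \<Rightarrow> nat \<Rightarrow> nat \<Rightarrow> nat \<Rightarrow> complex poly \<Rightarrow> complex poly \<Rightarrow> nat \<Rightarrow> complex" where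
  "residue_entry p q a b g h r =
    (if r < p
     then coeff ((g + (xpow a - xpow b) * (h div (xpow q - 1))) mod pert_poly p a b) r
     else coeff (h mod (xpow q - 1)) (r - p))"

lemma residue_entry_add:
  "residue_entry p q a b (g + g') (h + h') r =
     residue_entry p q a b g h r + residue_entry p q a b g' h' r"
  by (simp add: residue_entry_def poly_mod_add_left poly_div_add_left distrib_left)

lemma residue_entry_diff:
  "residue_entry p q a b (g - g') (h - h') r =
     residue_entry p q a b g h r - residue_entry p q a b g' h' r"
  using residue_entry_add[of p q a b "g - g'" g' "h - h'" h' r] by simp

lemma residue_entry_relation1:
  "residue_entry p q a b (g * pert_poly p a b) 0 r = 0"
  by (simp add: residue_entry_def)

text \<open>Dividing \<open>g * (xpow q - 1)\<close> by \<open>xpow q - 1\<close> gives quotient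
  \<open>g\<close> and remainder 0. The carried term \<open>(xpow a - xpow b) * g\<close> then
  cancels the first component.\<close>

lemma residue_entry_relation2:
  assumes "0 < q"
  shows "residue_entry p q a b ((xpow b - xpow a) * g) (g * (xpow q - 1)) r = 0"
proof -
  have "xpow q - 1 \<noteq> 0"
    using assms degree_xpow_minus_1[of q] by (metis degree_0 less_irrefl)
  moreover have "(xpow b - xpow a) * g + (xpow a - xpow b) * g = 0"
    by (simp add: algebra_simps)
  ultimately show ?thesis
    by (simp add: residue_entry_def)
qed

section \<open>Powers of the matrix as multiplication by \<open>x\<close>\<close>

lemma cyc_mat_entry:
  assumes "r < k" "c < k"
  shows "cyc_mat k $$ (r, c) = (if Suc c = k then if r = 0 then 1 else 0 else if r = Suc c then 1 else 0)"
  using assms by (auto simp: cyc_mat_def)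

text \<open>Only columns \<open>p - 1\<close> and \<open>p + q - 1\<close> differ from a plain
  shift: there the wrap-around entries of the cyclic blocks meet the entries of
  \<open>T_mat\<close>. These two columns are the relations for \<open>A^p e\<close> and
  \<open>A^q f\<close>.\<close>

lemma perturbed_entry:
  assumes "a < p" "b < p" "a \<noteq> b" "0 < q" "r < p + q" "c < p + q"
    and A: "A = diag_block_mat [cyc_mat p, cyc_mat q] + T_mat (p + q) (Suc a) (p + q) (Suc b) p"
  shows "A $$ (r, c) =
    (if Suc c = p then of_bool (r = 0) + of_bool (r = b) - of_bool (r = a)
     else if Suc c = p + q then of_bool (r = p) + of_bool (r = a) - of_bool (r = b)
     else of_bool (r = Suc c))"
proof -
  have dim: "dim_row (cyc_mat k) = k" "dim_col (cyc_mat k) = k" for k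
    by (simp_all add: cyc_mat_def)
  have "A $$ (r, c) =
     (if r < p then if c < p then cyc_mat p $$ (r, c) else 0
      else if c < p then 0 else cyc_mat q $$ (r - p, c - p))
     + T_mat (p + q) (Suc a) (p + q) (Suc b) p $$ (r, c)"
  proof -
    let ?D = "four_block_mat (cyc_mat p) (0\<^sub>m p q) (0\<^sub>m q p) (cyc_mat q)"
    let ?T = "T_mat (p + q) (Suc a) (p + q) (Suc b) p"
    have "A = ?D + ?T"
      unfolding A diag_block_mat.simps(2)[of "cyc_mat p"] diag_block_mat_singleton Let_def dim ..
    moreover have "dim_row ?T = p + q" "dim_col ?T = p + q" by (simp_all add: T_mat_def)
    ultimately have "A $$ (r, c) = ?D $$ (r, c) + ?T $$ (r, c)"
      using \<open>r < p + q\<close> \<open>c < p + q\<close> by simp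
    moreover have "?D $$ (r, c) = (if r < p then if c < p then cyc_mat p $$ (r, c) else 0
      else if c < p then 0 else cyc_mat q $$ (r - p, c - p))"
      using \<open>r < p + q\<close> \<open>c < p + q\<close>
      by (subst index_mat_four_block(1)) (simp_all add: dim less_diff_conv2)
    ultimately show ?thesis by simp
  qed
  then show ?thesis
    using assms by (auto simp: cyc_mat_entry T_mat_def Let_def)
qed

text \<open>Basis vector \<open>c\<close> is \<open>A^c e\<close> for \<open>c < p\<close> and
  \<open>A^(c - p) f\<close> otherwise, so column \<open>c\<close> of \<open>A^k\<close> is the
  class of a monomial in one component. In the induction, \<open>A^(k+1) = A^k A\<close> expresses
  each new column through several old ones, hence \<open>c\<close> is arbitrary.\<close>

lemma perturbed_power_entry:
  fixes A :: "int mat"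
  assumes ab: "a < p" "b < p" "a \<noteq> b" and q: "0 < q"
    and A: "A = diag_block_mat [cyc_mat p, cyc_mat q] + T_mat (p + q) (Suc a) (p + q) (Suc b) p"
    and "r < p + q" "c < p + q"
  shows "of_int ((A ^\<^sub>m k) $$ (r, c)) =
    (if c < p then residue_entry p q a b (xpow (k + c)) 0 r
     else residue_entry p q a b 0 (xpow (k + (c - p))) r)"
  using \<open>c < p + q\<close>
proof (induction k arbitrary: c)
  case 0
  have dA: "dim_row A = p + q" by (simp add: A T_mat_def)
  \<comment> \<open>For \<open>k = 0\<close> all exponents are below the degrees of the moduli, so
    nothing is reduced.\<close>
  have 1: "xpow j mod pert_poly p a b = xpow j" if "j < p" for j
    using that ab by (intro mod_poly_less) (simp add: degree_pert_poly)
  have 2: "xpow j mod (xpow q - 1) = xpow j" if "j < q" for j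
    using that by (intro mod_poly_less) simp
  have 3: "xpow j div (xpow q - 1) = 0" if "j < q" for j
    using that by (intro div_poly_less) simp
  show ?case using 0 \<open>r < p + q\<close>
    by (auto simp: dA residue_entry_def 1 2 3 coeff_xpow)
next
  case (Suc k)
  have dA: "dim_row A = p + q" "dim_col A = p + q" by (simp_all add: A T_mat_def)
  let ?B = "\<lambda>c. of_int ((A ^\<^sub>m k) $$ (r, c)) :: complex"
  have "of_int ((A ^\<^sub>m Suc k) $$ (r, c)) =
      (\<Sum>s<p + q. ?B s * of_int (A $$ (s, c)))"
    using Suc.prems \<open>r < p + q\<close>
    by (simp add: dA scalar_prod_def lessThan_atLeast0)
  also have "\<dots> = (if Suc c = p then ?B 0 + ?B b - ?B a
     else if Suc c = p + q then ?B p + ?B a - ?B b else ?B (Suc c))"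
  proof -
    have pick: "(\<Sum>s<p + q. ?B s * of_bool (s = t)) = ?B t" if "t < p + q" for t
      using that by (simp add: of_bool_def if_distrib cong: if_cong)
    have "(\<Sum>s<p + q. ?B s * of_int (A $$ (s, c))) = 
       (\<Sum>s<p + q. ?B s * of_int (if Suc c = p then of_bool (s = 0) + of_bool (s = b) - of_bool (s = a)
     else if Suc c = p + q then of_bool (s = p) + of_bool (s = a) - of_bool (s = b)
     else of_bool (s = Suc c)))"
      using Suc.prems by (intro sum.cong refl) (simp add: perturbed_entry[OF ab q _ _ A])
    also have "\<dots> = (if Suc c = p then ?B 0 + ?B b - ?B a
     else if Suc c = p + q then ?B p + ?B a - ?B b else ?B (Suc c))"
      using ab q Suc.prems
      by (simp add: distrib_left right_diff_distrib sum.distrib sum_subtractf pick)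
    finally show ?thesis .
  qed
  also have "\<dots> = (if c < p then residue_entry p q a b (xpow (Suc k + c)) 0 r
     else residue_entry p q a b 0 (xpow (Suc k + (c - p))) r)"
  proof -
    consider "Suc c = p" | "Suc c = p + q" "p \<le> c" | "Suc c \<noteq> p" "Suc c \<noteq> p + q"
      using q by linarith
    then show ?thesis
    proof cases
      case 1
      have "xpow (Suc k + c) = xpow k + xpow (k + b) - xpow (k + a) + xpow k * pert_poly p a b"
      proof -
        have "xpow (Suc k + c) = xpow k * xpow p"
          using 1 by (metis add_Suc_shift xpow_add)
        then show ?thesis by (simp add: pert_poly_def xpow_add algebra_simps)
      qed
      \<comment> \<open>The zero second component is split to match the first, so that additivity
        applies term by term.\<close>
      then have "residue_entry p q a b (xpow (Suc k + c)) 0 r =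
          residue_entry p q a b (xpow k + xpow (k + b) - xpow (k + a) + xpow k * pert_poly p a b)
            (0 + 0 - 0 + 0) r"
        by simp
      also have "\<dots> = ?B 0 + ?B b - ?B a"
        using 1 ab q unfolding residue_entry_add residue_entry_diff residue_entry_relation1
        by (simp add: Suc.IH)
      finally show ?thesis using 1 by simp
    next
      case 2
      have c: "Suc k + (c - p) = k + q" using 2 by linarith
      \<comment> \<open>This is \<open>x^q f = f + x^a e - x^b e\<close>, multiplied by
        \<open>x^k\<close>, with the second relation added as an explicit summand.\<close>
      have "residue_entry p q a b 0 (xpow (k + q)) r =
          residue_entry p q a b (0 + xpow (k + a) - xpow (k + b) + (xpow b - xpow a) * xpow k)
            (xpow k + 0 - 0 + xpow k * (xpow q - 1)) r"
        by (simp add: xpow_add algebra_simps)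
      also have "\<dots> = ?B p + ?B a - ?B b"
        using 2 ab q unfolding residue_entry_add residue_entry_diff residue_entry_relation2[OF q]
        by (simp add: Suc.IH)
      finally show ?thesis using 2 q unfolding c by simp
    next
      case 3
      then show ?thesis using Suc.prems by (auto simp: Suc.IH Suc_diff_le)
    qed
  qed
  finally show ?case .
qed

text \<open>As \<open>e\<close> and \<open>f\<close> generate, \<open>A^k = 1\<close> means that
  \<open>(x^k - 1, 0)\<close> and \<open>(0, x^k - 1)\<close> vanish in the quotient. The second
  requires \<open>x^q - 1\<close> to divide \<open>x^k - 1\<close> with a quotient \<open>G\<close>
  whose carry is divisible by \<open>F\<close>.\<close>

lemma finite_order_iff_dvd:
  fixes A :: "int mat"
  assumes ab: "a < p" "b < p" "a \<noteq> b" and q: "0 < q"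
    and A: "A = diag_block_mat [cyc_mat p, cyc_mat q] + T_mat (p + q) (Suc a) (p + q) (Suc b) p"
  shows "finite_mult_order A \<longleftrightarrow>
    (\<exists>k>0. \<exists>G. xpow k - 1 = G * (xpow q - 1) \<and> pert_poly p a b dvd xpow k - 1 \<and>
      pert_poly p a b dvd (xpow a - xpow b) * G)"
proof -
  have dA: "dim_row A = p + q" "dim_col A = p + q" by (simp_all add: A T_mat_def)
  let ?f = "pert_poly p a b"
  let ?Q = "xpow q - 1"
  have Q0: "?Q \<noteq> 0"
    using q degree_xpow_minus_1[of q] by (metis degree_0 less_irrefl)
  have f0: "?f \<noteq> 0"
    using ab degree_pert_poly[of a p b] by auto
  note entry = perturbed_power_entry[OF ab q A]
  have one: "(A ^\<^sub>m 0) $$ (r, c) = (1\<^sub>m (p + q)) $$ (r, c)" for r c by (simp add: dA)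
  have "A ^\<^sub>m k = 1\<^sub>m (p + q) \<longleftrightarrow>
      (\<exists>G. xpow k - 1 = G * ?Q \<and> ?f dvd xpow k - 1 \<and> ?f dvd (xpow a - xpow b) * G)" (is "?L \<longleftrightarrow> ?R") for k
  proof
    assume ?L
    then have eq: "(A ^\<^sub>m k) $$ (r, c) = (A ^\<^sub>m 0) $$ (r, c)" for r c
      using one by simp
    \<comment> \<open>Column 0 is the image of \<open>e\<close>; column \<open>p\<close>, used next,
      is the image of \<open>f\<close>.\<close>
    have E: "residue_entry p q a b (xpow k - 1) 0 r = 0" if "r < p + q" for r
    proof -
      have "residue_entry p q a b (xpow k - 1) (0 - 0) r = 0"
        unfolding residue_entry_diff
        using entry[OF that, of 0 k] entry[OF that, of 0 0] ab eq[of r 0] by simp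
      then show ?thesis by simp
    qed
    have F: "residue_entry p q a b 0 (xpow k - 1) r = 0" if "r < p + q" for r
    proof -
      have "residue_entry p q a b (0 - 0) (xpow k - 1) r = 0"
        unfolding residue_entry_diff
        using entry[OF that, of p k] entry[OF that, of p 0] q eq[of r p] by simp
      then show ?thesis by simp
    qed
    have small: "g mod ?f = 0" if "\<And>r. r < p \<Longrightarrow> coeff (g mod ?f) r = 0" for g
    proof (rule ccontr)
      assume "g mod ?f \<noteq> 0"
      then have "degree (g mod ?f) < p"
        using degree_mod_less'[OF f0, of g] degree_pert_poly[of a p b] ab by auto
      then show False using that \<open>g mod ?f \<noteq> 0\<close> leading_coeff_0_iff by blast
    qed
    have "(xpow k - 1) mod ?f = 0"
    proof (rule small)
      fix r assume "r < p"
      then show "coeff ((xpow k - 1) mod ?f) r = 0" using E[of r] by (simp add: residue_entry_def)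
    qed
    moreover define G where "G = (xpow k - 1) div ?Q"
    have "((xpow a - xpow b) * G) mod ?f = 0"
    proof (rule small)
      fix r assume "r < p"
      then show "coeff (((xpow a - xpow b) * G) mod ?f) r = 0"
        using F[of r] by (simp add: residue_entry_def G_def)
    qed
    moreover have "(xpow k - 1) mod ?Q = 0"
    proof (rule ccontr)
      assume nz: "(xpow k - 1) mod ?Q \<noteq> 0"
      then have "degree ((xpow k - 1) mod ?Q) < q"
        using degree_mod_less'[OF Q0] by simp
      then show False using F[of "p + degree ((xpow k - 1) mod ?Q)"] nz
        by (simp add: residue_entry_def)
    qed
    then have "xpow k - 1 = G * ?Q"
      by (simp add: G_def mod_eq_0_iff_dvd)
    ultimately show ?R by (auto simp: mod_eq_0_iff_dvd)
  next
    assume ?R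
    then obtain G H1 H2 where G: "xpow k - 1 = G * ?Q"
      and H: "xpow k - 1 = ?f * H1" "(xpow a - xpow b) * G = ?f * H2"
      unfolding dvd_def by blast
    show ?L
    proof (rule eq_matI)
      fix r c assume "r < dim_row (1\<^sub>m (p + q))" "c < dim_col (1\<^sub>m (p + q))"
      then have rc: "r < p + q" "c < p + q" by simp_all
      have "of_int ((A ^\<^sub>m k) $$ (r, c)) = (of_int ((A ^\<^sub>m 0) $$ (r, c)) :: complex)"
      proof (cases "c < p")
        case True
        have "xpow (k + c) = xpow c + (xpow c * H1) * ?f"
          using H(1) by (simp add: xpow_add algebra_simps)
        then have "residue_entry p q a b (xpow (k + c)) 0 r =
            residue_entry p q a b (xpow c + (xpow c * H1) * ?f) (0 + 0) r" by simp
        also have "\<dots> = residue_entry p q a b (xpow c) 0 r"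
          unfolding residue_entry_add residue_entry_relation1 by simp
        finally show ?thesis unfolding entry[OF rc] using True by simp
      next
        case False
        define c' where "c' = c - p"
        have "xpow (k + c') = xpow c' + 0 + (xpow c' * G) * ?Q"
        proof -
          have "xpow (k + c') = xpow c' + xpow c' * (xpow k - 1)"
            by (simp add: xpow_add algebra_simps)
          then show ?thesis by (simp add: G mult.assoc)
        qed
        moreover have "(xpow a - xpow b) * (xpow c' * G) = (xpow c' * H2) * ?f"
          using H(2) by (metis mult.assoc mult.commute)
        \<comment> \<open>The first component 0 is rewritten as a multiple of \<open>?f\<close> plus
          the part belonging to the second relation.\<close>
        then have "0 = 0 + (xpow c' * H2) * ?f + (xpow b - xpow a) * (xpow c' * G)"
          by (simp add: algebra_simps)
        ultimately have "residue_entry p q a b 0 (xpow (k + c')) r =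
            residue_entry p q a b (0 + (xpow c' * H2) * ?f + (xpow b - xpow a) * (xpow c' * G))
              (xpow c' + 0 + (xpow c' * G) * ?Q) r" by simp
        also have "\<dots> = residue_entry p q a b 0 (xpow c') r"
          unfolding residue_entry_add residue_entry_relation1 residue_entry_relation2[OF q] by simp
        finally show ?thesis unfolding entry[OF rc] using False by (simp add: c'_def)
      qed
      then show "(A ^\<^sub>m k) $$ (r, c) = 1\<^sub>m (p + q) $$ (r, c)"
        using one by simp
    qed (simp_all add: dA)
  qed
  then show ?thesis by (simp add: finite_mult_order_def dA)
qed

section \<open>Squarefree polynomials and the roots of \<open>F\<close>\<close>

lemma prod_linear_dvd:
  fixes g :: "'a::field poly"
  assumes "finite S" "\<And>z. z \<in> S \<Longrightarrow> poly g z = 0"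
  shows "(\<Prod>z\<in>S. [:- z, 1:]) dvd g"
  using assms
proof (induction S arbitrary: g rule: finite_induct)
  case (insert z S)
  from insert.prems obtain h where h: "g = [:- z, 1:] * h"
    by (metis dvdE insertI1 poly_eq_0_iff_dvd)
  have "poly h w = 0" if "w \<in> S" for w
    using insert.prems[of w] insert.hyps that by (auto simp: h)
  then have "(\<Prod>z\<in>S. [:- z, 1:]) dvd h" by (rule insert.IH)
  then show ?case
    unfolding h prod.insert[OF insert.hyps] by (rule mult_dvd_mono[OF dvd_refl])
qed simp

text \<open>Up to a nonzero scalar, a squarefree complex polynomial is the product of its distinct
  linear factors. This turns divisibility by \<open>F\<close> into a condition at its roots.\<close>

lemma rsquarefree_dvdI:
  fixes f g :: "complex poly"
  assumes "rsquarefree f" and "\<And>z. poly f z = 0 \<Longrightarrow> poly g z = 0"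
  shows "f dvd g"
proof -
  have f0: "f \<noteq> 0" using assms by (simp add: rsquarefree_def)
  then have "(\<Prod>z | poly f z = 0. [:- z, 1:]) dvd g"
    using assms by (intro prod_linear_dvd) (auto simp: poly_roots_finite)
  then show ?thesis
    using complex_poly_decompose_rsquarefree[OF assms(1)] f0
    by (metis leading_coeff_0_iff smult_dvd)
qed

text \<open>A multiple root of \<open>f\<close> would be a zero of both \<open>x^k - 1\<close> and
  its derivative \<open>k x^(k-1)\<close>; the latter can vanish only at 0, where the former does
  not.\<close>

lemma rsquarefree_if_dvd_xpow_minus_1:
  assumes "f dvd xpow k - 1" "0 < k"
  shows "rsquarefree f"
  unfolding rsquarefree_roots
proof (intro allI notI)
  fix z assume z: "poly f z = 0 \<and> poly (pderiv f) z = 0"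
  obtain h where h: "xpow k - 1 = f * h" using assms by (auto simp: dvd_def)
  have "poly (pderiv (xpow k - 1)) z = 0" unfolding h using z by (simp add: pderiv_mult)
  then have "of_nat k * z ^ (k - 1) = 0"
    by (simp add: xpow_def pderiv_diff pderiv_monom poly_monom)
  then have "z = 0" using assms by simp
  moreover have "poly (xpow k - 1) z = 0" unfolding h using z by simp
  ultimately show False using assms by (simp add: power_0_left)
qed

lemma coeff_pert_poly:
  "coeff (pert_poly p a b) i =
     of_bool (i = p) + of_bool (i = a) - of_bool (i = b) - of_bool (i = 0)"
  by (simp add: pert_poly_def coeff_xpow)

lemma poly_pert_poly: "poly (pert_poly p a b) z = z ^ p + z ^ a - z ^ b - 1"
  by (simp add: pert_poly_def)

text \<open>Roots on the unit circle satisfy \<open>1 / z = cnj z\<close>, so the reciprocal polynomial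
  vanishes wherever the real polynomial \<open>pert_poly p a b\<close> does.\<close>
lemma roots_of_unity_imp_sum_eq:
  assumes ab: "a < p" "b < p" "a \<noteq> b" and dvd: "pert_poly p a b dvd xpow k - 1" and "0 < k"
  shows "0 < a \<and> 0 < b \<and> a + b = p"
proof -
  let ?f = "pert_poly p a b"
  have unit: "z ^ k = 1" if "poly ?f z = 0" for z
  proof -
    have "poly (xpow k - 1) z = 0" using dvd that by (metis poly_eq_0_iff_dvd dvd_trans)
    then show ?thesis by simp
  qed
  have a: "0 < a"
  proof (rule ccontr)
    assume "\<not> 0 < a"
    then have "poly ?f 0 = 0" using ab by (simp add: poly_pert_poly power_0_left)
    from unit[OF this] \<open>0 < k\<close> show False by (simp add: power_0_left)
  qed
  \<comment> \<open>The reciprocal polynomial \<open>x^p F(1/x)\<close>.\<close>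
  define g where "g = 1 + xpow (p - a) - xpow (p - b) - xpow p"
  have coeff_g: "coeff g i =
      of_bool (i = 0) + of_bool (i = p - a) - of_bool (i = p - b) - of_bool (i = p)" for i
    by (simp add: g_def coeff_xpow)
  have "poly g z = 0" if "poly ?f z = 0" for z
  proof -
    have "norm z ^ k = 1" using unit[OF that] by (metis norm_one norm_power)
    then have "norm z = 1" using \<open>0 < k\<close> power_eq_imp_eq_base[of "norm z" k 1] by simp
    then have z: "z * cnj z = 1" by (simp add: complex_norm_square[symmetric])
    have zp: "z ^ p * cnj z ^ j = z ^ (p - j)" if "j \<le> p" for j
    proof -
      have "z ^ p * cnj z ^ j = z ^ (p - j) * (z ^ j * cnj z ^ j)"
        using that by (simp flip: power_add)
      then show ?thesis using z by (simp flip: power_mult_distrib)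
    qed
    have "cnj (poly ?f z) = 0" using that by simp
    then have "z ^ p * (cnj z ^ p + cnj z ^ a - cnj z ^ b - 1) = 0"
      by (simp add: poly_pert_poly)
    then show ?thesis
      using ab by (simp add: g_def algebra_simps zp)
  qed
  then have "?f dvd g"
    using rsquarefree_if_dvd_xpow_minus_1[OF dvd \<open>0 < k\<close>] by (rule rsquarefree_dvdI[rotated])
  have small: "h = 0" if "?f dvd h" "\<And>i. i \<ge> p \<Longrightarrow> coeff h i = 0" for h
  proof (rule ccontr)
    assume "h \<noteq> 0"
    with that have "coeff h (degree h) = 0"
      using dvd_imp_degree_le[of ?f h] ab by (simp add: degree_pert_poly)
    then show False using \<open>h \<noteq> 0\<close> by simp
  qed
  have b: "0 < b"
  proof (rule ccontr)
    assume "\<not> 0 < b"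
    then have b: "b = 0" by simp
    \<comment> \<open>For \<open>b = 0\<close> the leading coefficient of \<open>g\<close> is -2, so
      adding \<open>2 F\<close> cancels degree \<open>p\<close>; the constant term -3
      remains.\<close>
    have "?f dvd g + smult 2 ?f" using \<open>?f dvd g\<close> by (intro dvd_add dvd_smult) auto
    then have "g + smult 2 ?f = 0"
      by (rule small) (use a ab b in \<open>auto simp: coeff_g coeff_pert_poly\<close>)
    then have "coeff (g + smult 2 ?f) 0 = 0" by simp
    then show False using a ab b by (simp add: coeff_g coeff_pert_poly)
  qed
  \<comment> \<open>Now the leading coefficient of \<open>g\<close> is -1. The sum has degree below
    \<open>p\<close>, hence is zero, and its coefficient at \<open>a\<close> can cancel only if
    \<open>a = p - b\<close>.\<close>
  have "?f dvd g + ?f" using \<open>?f dvd g\<close> by simp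
  then have "g + ?f = 0"
    by (rule small) (use a b ab in \<open>auto simp: coeff_g coeff_pert_poly\<close>)
  then have "coeff (g + ?f) a = 0" by simp
  then have "a = p - b"
    using a b ab by (cases "a = p - b"; cases "a = p - a") (simp_all add: coeff_g coeff_pert_poly)
  then show ?thesis using a b ab by simp
qed

text \<open>The absence of a common root makes \<open>F = (x^a - 1) (x^b + 1)\<close> squarefree.
  The last condition governs \<open>F dvd (x^a - x^b) G\<close>: at roots of \<open>F\<close> with
  \<open>z^q = 1\<close> the value of \<open>G\<close> is nonzero, so \<open>z^a = z^b\<close> is
  forced; at the others \<open>G\<close> vanishes once \<open>z^k = 1\<close>.\<close>

lemma finite_order_iff_roots:
  fixes A :: "int mat"
  assumes ab: "a < p" "b < p" "a \<noteq> b" and q: "0 < q"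
    and A: "A = diag_block_mat [cyc_mat p, cyc_mat q] + T_mat (p + q) (Suc a) (p + q) (Suc b) p"
  shows "finite_mult_order A \<longleftrightarrow> 0 < a \<and> 0 < b \<and> a + b = p \<and>
     (\<nexists>z::complex. z ^ a = 1 \<and> z ^ b = -1) \<and>
     (\<forall>z::complex. z ^ q = 1 \<and> (z ^ a = 1 \<or> z ^ b = -1) \<longrightarrow> z ^ p = 1)" (is "_ \<longleftrightarrow> ?R")
proof
  let ?f = "pert_poly p a b"
  assume "finite_mult_order A"
  then obtain k G where k: "0 < k" and G: "xpow k - 1 = G * (xpow q - 1)"
    and dvd: "?f dvd xpow k - 1" "?f dvd (xpow a - xpow b) * G"
    using finite_order_iff_dvd[OF ab q A] by blast
  have abp: "0 < a" "0 < b" "a + b = p"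
    using roots_of_unity_imp_sum_eq[OF ab dvd(1) k] by auto
  have f: "poly ?f z = (z ^ a - 1) * (z ^ b + 1)" for z
    by (simp add: poly_pert_poly algebra_simps flip: abp(3) power_add)
  have "False" if z: "z ^ a = 1" "z ^ b = -1" for z :: complex
  proof -
    have "?f = (xpow a - 1) * (xpow b + 1)"
      by (simp add: pert_poly_def xpow_add algebra_simps flip: abp(3))
    then have "poly (pderiv ?f) z = 0" using z by (simp add: pderiv_mult)
    moreover have "poly ?f z = 0" using z by (simp add: f)
    ultimately show False
      using rsquarefree_if_dvd_xpow_minus_1[OF dvd(1) k] by (auto simp: rsquarefree_roots)
  qed
  moreover have "z ^ p = 1" if z: "z ^ q = 1" "z ^ a = 1 \<or> z ^ b = -1" for z :: complex
  proof -
    have fz: "poly ?f z = 0" using z by (auto simp: f)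
    have "z \<noteq> 0" using z q by (auto simp: power_0_left)
    \<comment> \<open>Differentiating \<open>x^k - 1 = G (x^q - 1)\<close> at a zero of
      \<open>x^q - 1\<close> isolates the value of \<open>G\<close>.\<close>
    have "poly (pderiv (xpow k - 1)) z = poly G z * poly (pderiv (xpow q - 1)) z"
      unfolding G using z by (simp add: pderiv_mult)
    then have "of_nat k * z ^ (k - 1) = poly G z * (of_nat q * z ^ (q - 1))"
      by (simp add: xpow_def pderiv_diff pderiv_monom poly_monom)
    then have "poly G z \<noteq> 0" using \<open>z \<noteq> 0\<close> k by auto
    moreover have "poly ((xpow a - xpow b) * G) z = 0"
      using dvd(2) fz by (metis poly_eq_0_iff_dvd dvd_trans)
    ultimately have "z ^ a = z ^ b" by simp
    with fz show ?thesis by (simp add: poly_pert_poly)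
  qed
  ultimately show ?R using abp by blast
next
  let ?f = "pert_poly p a b"
  assume ?R
  then have abp: "0 < a" "0 < b" "a + b = p" and nc: "\<And>z::complex. z ^ a = 1 \<Longrightarrow> z ^ b \<noteq> -1"
    and zp: "\<And>z::complex. z ^ q = 1 \<Longrightarrow> z ^ a = 1 \<or> z ^ b = -1 \<Longrightarrow> z ^ p = 1" by auto
  have f: "?f = (xpow a - 1) * (xpow b + 1)"
    by (simp add: pert_poly_def xpow_add algebra_simps flip: abp(3))
  have root: "z ^ a = 1 \<or> z ^ b = -1" if "poly ?f z = 0" for z
    using that by (auto simp: f eq_neg_iff_add_eq_0)
  have sf: "rsquarefree ?f"
    unfolding rsquarefree_roots
  proof (intro allI notI)
    fix z assume z: "poly ?f z = 0 \<and> poly (pderiv ?f) z = 0"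
    then have ab1: "z ^ a = 1 \<or> z ^ b = -1" using root by blast
    then have "z \<noteq> 0" using abp by (auto simp: power_0_left)
    \<comment> \<open>By the product rule, at a root of one factor only the term with that factor's
      derivative survives, and it is nonzero.\<close>
    have "of_nat a * z ^ (a - 1) * (z ^ b + 1) + (z ^ a - 1) * (of_nat b * z ^ (b - 1)) = 0"
      using z by (simp add: f xpow_def pderiv_diff pderiv_add pderiv_mult pderiv_monom poly_monom algebra_simps)
    with ab1 nc[of z] \<open>z \<noteq> 0\<close> abp show False by (auto simp: eq_neg_iff_add_eq_0)
  qed
  \<comment> \<open>A common multiple of \<open>q\<close>, \<open>a\<close> and
    \<open>2 * b\<close>, so that all roots of \<open>F\<close> and of \<open>x^q - 1\<close> are
    \<open>k\<close>-th roots of unity.\<close>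
  define k where "k = q * (2 * a * b)"
  have k1: "z ^ k = 1" if "z ^ a = 1 \<or> z ^ b = -1" for z :: complex
  proof -
    have "z ^ k = (z ^ a) ^ (2 * b * q)" "z ^ k = ((z ^ b) ^ 2) ^ (a * q)"
      by (simp_all add: k_def ac_simps flip: power_mult)
    then show ?thesis using that by auto
  qed
  have "xpow q - 1 dvd xpow k - 1"
  proof -
    have "xpow k = xpow q ^ (2 * a * b)" by (simp add: k_def xpow_def monom_power)
    then show ?thesis by (metis dvd_triv_left power_diff_1_eq)
  qed
  then obtain G where G: "xpow k - 1 = G * (xpow q - 1)" by (metis dvdE mult.commute)
  have "?f dvd xpow k - 1"
    by (rule rsquarefree_dvdI[OF sf]) (use root k1 in auto)
  moreover have "?f dvd (xpow a - xpow b) * G"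
  proof (rule rsquarefree_dvdI[OF sf])
    fix z assume z: "poly ?f z = 0"
    show "poly ((xpow a - xpow b) * G) z = 0"
    proof (cases "z ^ q = 1")
      case True
      then have "z ^ p = 1" using zp root[OF z] by blast
      with z show ?thesis by (simp add: poly_pert_poly)
    next
      case False
      have "z ^ k - 1 = poly G z * (z ^ q - 1)"
        using arg_cong[OF G, of "\<lambda>h. poly h z"] by simp
      with False k1[OF root[OF z]] show ?thesis by simp
    qed
  qed
  moreover have "0 < k" using q abp by (simp add: k_def)
  ultimately show "finite_mult_order A"
    using finite_order_iff_dvd[OF ab q A] G by blast
qed

section \<open>Roots of unity and the numerical conditions\<close>

lemma primitive_root_exists:
  assumes "0 < n"
  obtains z :: complex where "\<And>j. z ^ j = 1 \<longleftrightarrow> n dvd j"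
proof
  fix j
  have "exp (2 * of_real pi * \<i> / of_nat n) ^ j =
      exp (2 * of_real pi * \<i> * of_nat j / of_nat n)"
    by (simp add: mult_ac flip: exp_of_nat_mult)
  then show "exp (2 * of_real pi * \<i> / of_nat n) ^ j = 1 \<longleftrightarrow> n dvd j"
    using complex_root_unity_eq_1[of n j] assms by simp
qed

lemma power_eq_neg1I:
  fixes z :: "'a::idom"
  assumes "z ^ (2 * m) = 1" "z ^ m \<noteq> 1"
  shows "z ^ m = -1"
  using assms by (metis power_even_eq power2_eq_1_iff)

lemma power_gcd_eq_1:
  fixes z :: "'a::idom"
  assumes "z ^ m = 1" "z ^ n = 1"
  shows "z ^ gcd m n = 1"
proof (cases "m = 0")
  case False
  then obtain x y where xy: "m * x = n * y + gcd m n" using bezout_nat by blast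
  have "z ^ (m * x) = z ^ (n * y) * z ^ gcd m n" by (simp add: xy power_add)
  then show ?thesis using assms by (simp add: power_mult)
qed (use assms in simp)

text \<open>If \<open>z^b = -1\<close>, the order of \<open>z\<close> contains a higher power of 2
  than \<open>b\<close>, and it has to divide \<open>s\<close>.\<close>

lemma common_root_iff:
  assumes "0 < s" "0 < b"
  shows "(\<exists>z::complex. z ^ s = 1 \<and> z ^ b = -1) \<longleftrightarrow> multiplicity 2 b < multiplicity 2 s"
proof -
  define \<beta> where "\<beta> = multiplicity 2 b"
  obtain b' where b: "b = 2 ^ \<beta> * b'" "odd b'"
    using assms(2) multiplicity_decompose'[of b 2] unfolding \<beta>_def by auto
  obtain s' where s: "s = 2 ^ multiplicity 2 s * s'" "odd s'"
    using assms(1) multiplicity_decompose'[of s 2] by auto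
  show ?thesis
    unfolding \<beta>_def[symmetric]
  proof
    assume "\<exists>z::complex. z ^ s = 1 \<and> z ^ b = -1"
    then obtain z :: complex where z: "z ^ s = 1" "z ^ b = -1" by blast
    show "\<beta> < multiplicity 2 s"
    proof (rule ccontr)
      assume "\<not> \<beta> < multiplicity 2 s"
      \<comment> \<open>With \<open>s'\<close> odd, \<open>z^(b s')\<close> would be both 1 and
        -1.\<close>
      then have "s dvd b * s'"
        by (subst s(1), subst b(1)) (simp add: le_imp_power_dvd mult_dvd_mono)
      then have "z ^ (b * s') = 1" using z(1) by (metis dvdE power_mult power_one)
      then show False using z(2) s(2) by (simp add: power_mult)
    qed
  next
    assume lt: "\<beta> < multiplicity 2 s"
    \<comment> \<open>The order \<open>2 ^ Suc \<beta>\<close> divides \<open>s\<close> and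
      \<open>2 * b\<close> but not \<open>b\<close>, so \<open>z^b\<close> is a square root of 1
      other than 1.\<close>
    obtain z :: complex where z: "\<And>j. z ^ j = 1 \<longleftrightarrow> 2 ^ Suc \<beta> dvd j"
      using primitive_root_exists[of "2 ^ Suc \<beta>"] by auto
    have "2 ^ Suc \<beta> dvd s" using lt by (intro multiplicity_dvd') simp
    moreover have "\<not> 2 ^ Suc \<beta> dvd b" using b by simp
    moreover have "2 ^ Suc \<beta> dvd 2 * b" by (simp add: b(1))
    ultimately show "\<exists>z::complex. z ^ s = 1 \<and> z ^ b = -1"
      using z power_eq_neg1I[of z b] by auto
  qed
qed

text \<open>The common roots of \<open>x^q - 1\<close> and \<open>x^a - 1\<close> are the roots of
  unity of order dividing \<open>gcd q a\<close>; a primitive one tests divisibility.\<close>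

lemma unity_condition_iff:
  assumes "0 < q" "0 < a"
  shows "(\<forall>z::complex. z ^ q = 1 \<and> z ^ a = 1 \<longrightarrow> z ^ p = 1) \<longleftrightarrow> gcd q a dvd p"
proof
  assume *: "\<forall>z::complex. z ^ q = 1 \<and> z ^ a = 1 \<longrightarrow> z ^ p = 1"
  obtain z :: complex where "\<And>j. z ^ j = 1 \<longleftrightarrow> gcd q a dvd j"
    using primitive_root_exists[of "gcd q a"] assms by auto
  with * show "gcd q a dvd p" by auto
next
  assume "gcd q a dvd p"
  then obtain t where t: "p = gcd q a * t" by (rule dvdE)
  show "\<forall>z::complex. z ^ q = 1 \<and> z ^ a = 1 \<longrightarrow> z ^ p = 1"
    unfolding t by (simp add: power_mult power_gcd_eq_1)
qed

text \<open>All \<open>z\<close> in question satisfy \<open>z^(2d) = 1\<close> with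
  \<open>2d = gcd q (2 * b)\<close>, and a primitive \<open>2d\<close>-th root of unity is one of
  them because \<open>2d\<close> does not divide \<open>b\<close>.\<close>

lemma neg_unity_condition_iff:
  assumes "0 < q" "0 < b" and lt: "multiplicity 2 b < multiplicity 2 q"
  shows "(\<forall>z::complex. z ^ q = 1 \<and> z ^ b = -1 \<longrightarrow> z ^ p = 1) \<longleftrightarrow> 2 * gcd (q div 2) b dvd p"
proof -
  define d where "d = gcd (q div 2) b"
  have "even q" using lt not_dvd_imp_multiplicity_0 by fastforce
  then have gcd2: "gcd q (2 * b) = 2 * d"
    unfolding d_def by (metis dvd_mult_div_cancel gcd_mult_distrib_nat)
  have "0 < d" using assms by (simp add: d_def)
  have nd: "\<not> 2 * d dvd b"
  proof
    assume "2 * d dvd b"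
    \<comment> \<open>\<open>2d\<close> inherits from \<open>q\<close> and \<open>2 * b\<close> one
      more factor 2 than \<open>b\<close> has.\<close>
    have "2 ^ Suc (multiplicity 2 b) dvd gcd q (2 * b)"
    proof (rule gcd_greatest)
      show "2 ^ Suc (multiplicity 2 b) dvd q" using lt by (intro multiplicity_dvd') simp
    qed (simp add: multiplicity_dvd)
    also have "\<dots> dvd b" using \<open>2 * d dvd b\<close> gcd2 by simp
    finally show False using \<open>0 < b\<close> power_dvd_iff_le_multiplicity[of b 2 "Suc (multiplicity 2 b)"]
      by simp
  qed
  show ?thesis
    unfolding d_def[symmetric]
  proof
    assume *: "\<forall>z::complex. z ^ q = 1 \<and> z ^ b = -1 \<longrightarrow> z ^ p = 1"
    obtain z :: complex where z: "\<And>j. z ^ j = 1 \<longleftrightarrow> 2 * d dvd j"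
      using primitive_root_exists[of "2 * d"] \<open>0 < d\<close> by auto
    have "2 * d dvd q" "2 * d dvd 2 * b" by (simp_all flip: gcd2)
    then have "z ^ q = 1" "z ^ b = -1" using z nd power_eq_neg1I[of z b] by auto
    with * z show "2 * d dvd p" by blast
  next
    assume dvd: "2 * d dvd p"
    show "\<forall>z::complex. z ^ q = 1 \<and> z ^ b = -1 \<longrightarrow> z ^ p = 1"
    proof (intro allI impI)
      fix z :: complex assume z: "z ^ q = 1 \<and> z ^ b = -1"
      then have "z ^ (2 * b) = 1" by (simp add: power_even_eq)
      with z have "z ^ (2 * d) = 1" using power_gcd_eq_1[of z q "2 * b"] by (simp add: gcd2)
      moreover obtain t where "p = 2 * d * t" using dvd by (rule dvdE)
      ultimately show "z ^ p = 1" by (simp only: power_mult power_one)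
    qed
  qed
qed

theorem theorem4p8:
  fixes p q n i1 i2 :: nat and A :: "int mat"
  assumes "0 < p" and "0 < q" and "n = p + q"
    and "1 \<le> i1" and "i1 \<le> p" and "1 \<le> i2" and "i2 \<le> p" and "i1 \<noteq> i2"
    and "A = diag_block_mat [cyc_mat p, cyc_mat q] + T_mat n i1 n i2 p"
  shows "finite_mult_order A \<longleftrightarrow>
    (i1 + i2 = p + 2 \<and> two_part (i2 - 1) \<ge> two_part (p - i2 + 1)) \<and>
    gcd q (p - i2 + 1) dvd p \<and>
    (two_part q \<le> two_part (i2 - 1) \<or>
     (two_part q > two_part (i2 - 1) \<and>
      (let d = gcd (q div 2) (i2 - 1) in d dvd p \<and> even (p div d))))"
proof -
  define a b where "a = i1 - 1" and "b = i2 - 1"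
  have ab: "a < p" "b < p" "a \<noteq> b" using assms by (auto simp: a_def b_def)
  have i: "i1 = Suc a" "i2 = Suc b" using assms by (auto simp: a_def b_def)
  have A: "A = diag_block_mat [cyc_mat p, cyc_mat q] + T_mat (p + q) (Suc a) (p + q) (Suc b) p"
    using assms by (simp add: i)
  \<comment> \<open>Both \<open>a\<close> and \<open>b\<close> are below \<open>p\<close>, so
    \<open>a + b = p\<close> already makes them positive.\<close>
  have sum: "i1 + i2 = p + 2 \<longleftrightarrow> 0 < a \<and> 0 < b \<and> a + b = p"
    using ab by (auto simp: i)
  have two_part_less: "two_part s < two_part t \<longleftrightarrow> multiplicity 2 s < multiplicity 2 t" for s t
    by (simp add: two_part_def)
  show ?thesis
  proof (cases "0 < a \<and> 0 < b \<and> a + b = p")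
    case False
    then show ?thesis
      unfolding finite_order_iff_roots[OF ab \<open>0 < q\<close> A] sum by blast
  next
    case True
    then have pa: "p - i2 + 1 = a" "i2 - 1 = b" by (auto simp: i)
    let ?d = "gcd (q div 2) b"
    have even_quot: "?d dvd p \<and> even (p div ?d) \<longleftrightarrow> 2 * ?d dvd p"
      using True by (auto simp: dvd_div_iff_mult dest: dvd_mult_right)
    \<comment> \<open>If \<open>[q]_2 \<le> [b]_2\<close>, no \<open>z\<close> has
      \<open>z^q = 1\<close> and \<open>z^b = -1\<close>, and the condition is vacuous; this is the
      first alternative of (3).\<close>
    have neg: "(\<forall>z::complex. z ^ q = 1 \<and> z ^ b = -1 \<longrightarrow> z ^ p = 1) \<longleftrightarrow>
        \<not> two_part b < two_part q \<or> 2 * ?d dvd p"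
    proof (cases "two_part b < two_part q")
      case True2: True
      then show ?thesis
        using neg_unity_condition_iff[of q b p] \<open>0 < q\<close> True by (simp add: two_part_less)
    next
      case False
      then show ?thesis
        using common_root_iff[of q b] \<open>0 < q\<close> True unfolding two_part_less by blast
    qed
    have "finite_mult_order A \<longleftrightarrow>
       \<not> (\<exists>z::complex. z ^ a = 1 \<and> z ^ b = -1) \<and>
       (\<forall>z::complex. z ^ q = 1 \<and> z ^ a = 1 \<longrightarrow> z ^ p = 1) \<and>
       (\<forall>z::complex. z ^ q = 1 \<and> z ^ b = -1 \<longrightarrow> z ^ p = 1)"
      unfolding finite_order_iff_roots[OF ab \<open>0 < q\<close> A] using True by blast
    also have "\<dots> \<longleftrightarrow> \<not> two_part b < two_part a \<and> gcd q a dvd p \<and>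
        (\<not> two_part b < two_part q \<or> 2 * ?d dvd p)"
      unfolding neg
      using common_root_iff[of a b] unity_condition_iff[of q a p] \<open>0 < q\<close> True
      by (simp add: two_part_less)
    finally show ?thesis
      unfolding sum pa Let_def even_quot using True by (auto simp: not_less)
  qed
qed

end
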